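(* Let $\alpha\ge 0$ be given. Then there exist non-trivial functions $f(t)$ and $g(t)$, $t\ge 0$, such that $$\omega(t,x,y)=-1+f(t)\cos(x-ty),\qquad \theta(t,x,y)=\alpha y+g(t)\sin(x-ty),$$ $$v(t,x,y)=(y,0)+\frac{f(t)}{1+t^2}\nabla^\perp\cos(x-ty)$$ are a solution of the nonlinear inviscid Boussinesq equations for all times. Moreover, if $\alpha>\tfrac14$, then $$E(t):=\frac{|\alpha|}{\sqrt{1+t^2}}|f(t)|^2+\sqrt{1+t^2}\,|g(t)|^2$$ satisfies $$c\,E(0)\le E(t)\le C\,E(0)$$ for all $t\geq 0$, for some constants $0<c<C<\infty$ depending on $\alpha$.
   Context: The inviscid Boussinesq equations on $(t,x,y)\in\mathbb{R}^+\times\mathbb{T}\times\mathbb{R}$, $\mathbb{T}=\mathbb{R}/2\pi\mathbb{Z}$, are $$\partial_tv+v\cdot\nabla v+\nabla p=\theta e_2,\qquad \partial_t\theta+v\cdot\nabla\theta=0,\qquad \operatorname{div}v=0,$$ for velocity $v=(v_1,v_2)$, temperature $\theta$ and some pressure $p$, with $e_2=(0,1)$. The vorticity is $\omega=\partial_xv_2-\partial_yv_1$. Convention: $\nabla^\perp=(\partial_y,-\partial_x)$. "Non-trivial" means $(f,g)\not\equiv(0,0)$. *)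

theory Defs
  imports "HOL-Analysis.Analysis"
begin

text \<open>
  Fields on the time-space domain are curried functions of \<open>t\<close>, \<open>x\<close>, \<open>y\<close>; only their values
  for \<open>t \<ge> 0\<close> matter. A function on \<open>\<real>/2\<pi>\<int> \<times> \<real>\<close> is a function on the plane that is
  \<open>2\<pi>\<close>-periodic in \<open>x\<close>.
\<close>

definition partial_t :: "(real \<Rightarrow> real \<Rightarrow> real \<Rightarrow> 'a::real_normed_vector) \<Rightarrow> real \<Rightarrow> real \<Rightarrow> real \<Rightarrow> 'a"
  where \<comment> \<open>one-sided at \<open>t = 0\<close>\<close>
  "partial_t u t x y = vector_derivative (\<lambda>s. u s x y) (at t within {0..})"

definition partial_x :: "(real \<Rightarrow> real \<Rightarrow> 'a::real_normed_vector) \<Rightarrow> real \<Rightarrow> real \<Rightarrow> 'a"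
  where "partial_x h x y = vector_derivative (\<lambda>r. h r y) (at x)"

definition partial_y :: "(real \<Rightarrow> real \<Rightarrow> 'a::real_normed_vector) \<Rightarrow> real \<Rightarrow> real \<Rightarrow> 'a"
  where "partial_y h x y = vector_derivative (\<lambda>r. h x r) (at y)"

definition grad :: "(real \<Rightarrow> real \<Rightarrow> real) \<Rightarrow> real \<Rightarrow> real \<Rightarrow> real \<times> real"
  where "grad h x y = (partial_x h x y, partial_y h x y)"

definition grad_perp :: "(real \<Rightarrow> real \<Rightarrow> real) \<Rightarrow> real \<Rightarrow> real \<Rightarrow> real \<times> real"
  where "grad_perp h x y = (partial_y h x y, - partial_x h x y)"

definition divergence :: "(real \<Rightarrow> real \<Rightarrow> real \<times> real) \<Rightarrow> real \<Rightarrow> real \<Rightarrow> real"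
  where "divergence w x y =
    partial_x (\<lambda>a b. fst (w a b)) x y + partial_y (\<lambda>a b. snd (w a b)) x y"

definition curl :: "(real \<Rightarrow> real \<Rightarrow> real \<times> real) \<Rightarrow> real \<Rightarrow> real \<Rightarrow> real"
  where "curl w x y =
    partial_x (\<lambda>a b. snd (w a b)) x y - partial_y (\<lambda>a b. fst (w a b)) x y"

definition advect :: "(real \<Rightarrow> real \<Rightarrow> real \<times> real) \<Rightarrow> (real \<Rightarrow> real \<Rightarrow> 'a::real_normed_vector)
    \<Rightarrow> real \<Rightarrow> real \<Rightarrow> 'a"
  where \<comment> \<open>\<open>(w \<cdot> \<nabla>) h\<close>\<close>
  "advect w h x y = fst (w x y) *\<^sub>R partial_x h x y + snd (w x y) *\<^sub>R partial_y h x y"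

definition periodic_x :: "(real \<Rightarrow> real \<Rightarrow> 'a) \<Rightarrow> bool"
  where "periodic_x h \<longleftrightarrow> (\<forall>x y. h (x + 2 * pi) y = h x y)"

definition C1_field :: "(real \<Rightarrow> real \<Rightarrow> real \<Rightarrow> 'a::real_normed_vector) \<Rightarrow> bool"
  where "C1_field u \<longleftrightarrow>
    (\<lambda>(t, x, y). u t x y) differentiable_on ({0..} \<times> UNIV) \<and>
    continuous_on ({0..} \<times> UNIV) (\<lambda>(t, x, y). partial_t u t x y) \<and>
    continuous_on ({0..} \<times> UNIV) (\<lambda>(t, x, y). partial_x (u t) x y) \<and>
    continuous_on ({0..} \<times> UNIV) (\<lambda>(t, x, y). partial_y (u t) x y)"

text \<open>
  Classical solutions, global in time. The pressure is only determined up to a function of time,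
  so no regularity in time is imposed on it; continuity of its spatial gradient follows from the
  momentum equation.
\<close>

definition boussinesq_solution :: "(real \<Rightarrow> real \<Rightarrow> real \<Rightarrow> real \<times> real) \<Rightarrow>
    (real \<Rightarrow> real \<Rightarrow> real \<Rightarrow> real) \<Rightarrow> (real \<Rightarrow> real \<Rightarrow> real \<Rightarrow> real) \<Rightarrow> bool"
  where "boussinesq_solution v \<omega> \<theta> \<longleftrightarrow>
    C1_field v \<and> C1_field \<theta> \<and>
    (\<forall>t\<ge>0. periodic_x (v t) \<and> periodic_x (\<theta> t)) \<and>
    (\<exists>p :: real \<Rightarrow> real \<Rightarrow> real \<Rightarrow> real.
      (\<forall>t\<ge>0. periodic_x (p t) \<and> (\<lambda>(x, y). p t x y) differentiable_on UNIV) \<and>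
      (\<forall>t\<ge>0. \<forall>x y.
        partial_t v t x y + advect (v t) (v t) x y + grad (p t) x y = \<theta> t x y *\<^sub>R (0, 1))) \<and>
    (\<forall>t\<ge>0. \<forall>x y. partial_t \<theta> t x y + advect (v t) (\<theta> t) x y = 0) \<and>
    (\<forall>t\<ge>0. \<forall>x y. divergence (v t) x y = 0) \<and>
    (\<forall>t\<ge>0. \<forall>x y. \<omega> t x y = curl (v t) x y)"

definition wave_vorticity :: "(real \<Rightarrow> real) \<Rightarrow> real \<Rightarrow> real \<Rightarrow> real \<Rightarrow> real"
  where "wave_vorticity f t x y = -1 + f t * cos (x - t * y)"

definition wave_temperature :: "real \<Rightarrow> (real \<Rightarrow> real) \<Rightarrow> real \<Rightarrow> real \<Rightarrow> real \<Rightarrow> real"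
  where "wave_temperature \<alpha> g t x y = \<alpha> * y + g t * sin (x - t * y)"

definition wave_velocity :: "(real \<Rightarrow> real) \<Rightarrow> real \<Rightarrow> real \<Rightarrow> real \<Rightarrow> real \<times> real"
  where "wave_velocity f t x y =
    (y, 0) + (f t / (1 + t\<^sup>2)) *\<^sub>R grad_perp (\<lambda>a b. cos (a - t * b)) x y"

definition wave_energy :: "real \<Rightarrow> (real \<Rightarrow> real) \<Rightarrow> (real \<Rightarrow> real) \<Rightarrow> real \<Rightarrow> real"
  where "wave_energy \<alpha> f g t =
    \<bar>\<alpha>\<bar> / sqrt (1 + t\<^sup>2) * \<bar>f t\<bar>\<^sup>2 + sqrt (1 + t\<^sup>2) * \<bar>g t\<bar>\<^sup>2"

text \<open>\<open>f\<close> and \<open>g\<close> are functions on \<open>[0, \<infinity>)\<close>, hence the restriction to \<open>t \<ge> 0\<close>.\<close>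

definition nontrivial_pair :: "(real \<Rightarrow> real) \<Rightarrow> (real \<Rightarrow> real) \<Rightarrow> bool"
  where "nontrivial_pair f g \<longleftrightarrow> (\<exists>t\<ge>0. (f t, g t) \<noteq> (0, 0))"

end

theory Submission
  imports Defs
begin

text \<open>
  A wave profile depending on \<open>x - t y\<close> only is transported by the Couette flow \<open>(y, 0)\<close> and by the
  velocity of the wave itself, so the quadratic terms cancel and the system reduces to
  \<open>f' = g\<close>, \<open>g' = - \<alpha> f / (1 + t\<^sup>2)\<close>. Conversely, comparing the mixed derivatives of the pressure
  recovers \<open>f' = g\<close> from the momentum equation. Global solutions of the linear system are
  obtained as series of iterated integrals.

  For the bounds, write \<open>r = sqrt (1 + t\<^sup>2)\<close>. The corrected energy \<open>H = E - (t / r) f g\<close> satisfies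
  \<open>H' = - f g / r\<^sup>3\<close>, and \<open>\<bar>f g\<bar> \<le> E / (2 sqrt \<alpha>)\<close>. So for \<open>\<alpha> > 1 / 4\<close> the energy \<open>H\<close> is
  comparable to \<open>E\<close> and \<open>\<bar>H'\<bar> \<le> \<kappa> H / r\<^sup>3\<close>; since \<open>1 / r\<^sup>3\<close> is the derivative of the bounded
  function \<open>t / r\<close>, Gronwall's argument applies.
\<close>

section \<open>Iterated integrals and a linear second-order equation\<close>

lemma integral_has_real_derivative_atLeast:
  fixes h :: "real \<Rightarrow> real"
  assumes "continuous_on {a..} h" "a \<le> t"
  shows "((\<lambda>t. integral {a..t} h) has_real_derivative h t) (at t within {a..})"
proof -
  have "((\<lambda>t. integral {a..t} h) has_real_derivative h t) (at t within {a..t+1})"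
    by (rule integral_has_real_derivative) (use assms in \<open>auto intro: continuous_on_subset\<close>)
  \<comment> \<open>The compact interval ends beyond \<open>t\<close>, so near \<open>t\<close> it
    coincides with the half line and both filters agree.\<close>
  moreover have "at t within {a..t+1} = at t within {a..}"
    by (rule at_within_nhd[of _ "{..<t+1}"]) auto
  ultimately show ?thesis by simp
qed

text \<open>The terms of a Picard (Peano-Baker) series. The weight depends on the level
  \<open>k\<close>, so one sequence can serve both unknowns of a system by alternating their
  coupling coefficients.\<close>

primrec iterated_integral :: "(nat \<Rightarrow> real \<Rightarrow> real) \<Rightarrow> nat \<Rightarrow> real \<Rightarrow> real" where
  "iterated_integral c 0 = (\<lambda>t. 1)"
| "iterated_integral c (Suc k) = (\<lambda>t. integral {0..t} (\<lambda>s. c k s * iterated_integral c k s))"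

lemma iterated_integral_continuous:
  assumes "\<And>k. continuous_on {0..} (c k)"
  shows "continuous_on {0..} (iterated_integral c k)"
proof (induction k)
  case (Suc k)
  then have "continuous_on {0..} (\<lambda>s. c k s * iterated_integral c k s)"
    by (intro continuous_intros assms)
  from integral_has_real_derivative_atLeast[OF this] show ?case
    by (auto intro!: DERIV_continuous simp: continuous_on_eq_continuous_within)
qed simp

lemma iterated_integral_has_derivative:
  assumes "\<And>k. continuous_on {0..} (c k)" "t \<ge> 0"
  shows "(iterated_integral c (Suc k) has_real_derivative c k t * iterated_integral c k t)
    (at t within {0..})"
  unfolding iterated_integral.simps
  by (intro integral_has_real_derivative_atLeast continuous_intros iterated_integral_continuous assms)

text \<open>Unfolded, the \<open>k\<close>-fold integral runs over a simplex of volume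
  \<open>t ^ k / fact k\<close> with an integrand of size at most \<open>M ^ k\<close>. The
  induction integrates the previous bound.\<close>

lemma iterated_integral_bound:
  assumes cont: "\<And>k. continuous_on {0..} (c k)"
    and bound: "\<And>k t. t \<ge> 0 \<Longrightarrow> \<bar>c k t\<bar> \<le> M" and "t \<ge> 0"
  shows "\<bar>iterated_integral c k t\<bar> \<le> (M * t) ^ k / fact k"
  using \<open>t \<ge> 0\<close>
proof (induction k arbitrary: t)
  case (Suc k)
  have M: "M \<ge> 0" using bound[of 0 0] by simp
  let ?h = "\<lambda>s. c k s * iterated_integral c k s"
  have ch: "continuous_on {0..} ?h"
    by (intro continuous_intros cont iterated_integral_continuous)
  have prim: "((\<lambda>s. M * (M * s) ^ k / fact k) has_integral
      (M * t) ^ Suc k / fact (Suc k) - (M * 0) ^ Suc k / fact (Suc k)) {0..t}"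
  proof (rule fundamental_theorem_of_calculus)
    fix s
    have "((\<lambda>s. (M * s) ^ Suc k / fact (Suc k)) has_real_derivative
        real (Suc k) * (M * s) ^ k * M / fact (Suc k)) (at s within {0..t})"
      by (rule derivative_eq_intros refl)+ simp_all
    moreover have "real (Suc k) * (M * s) ^ k * M / fact (Suc k) = M * (M * s) ^ k / fact k"
      by (simp add: divide_simps del: of_nat_Suc)
    ultimately show "((\<lambda>s. (M * s) ^ Suc k / fact (Suc k)) has_vector_derivative
        M * (M * s) ^ k / fact k) (at s within {0..t})"
      by (simp only: has_real_derivative_iff_has_vector_derivative)
  qed (rule Suc.prems)
  have "norm (integral {0..t} ?h) \<le> integral {0..t} (\<lambda>s. M * (M * s) ^ k / fact k)"
  proof (rule integral_norm_bound_integral)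
    show "?h integrable_on {0..t}"
      by (rule integrable_continuous_real) (rule continuous_on_subset[OF ch], auto)
    show "(\<lambda>s. M * (M * s) ^ k / fact k) integrable_on {0..t}"
      using prim by blast
    fix s assume "s \<in> {0..t}"
    then have "\<bar>c k s\<bar> * \<bar>iterated_integral c k s\<bar> \<le> M * ((M * s) ^ k / fact k)"
      using bound Suc.IH M by (intro mult_mono) auto
    then show "norm (?h s) \<le> M * (M * s) ^ k / fact k"
      by (simp add: abs_mult)
  qed
  also have "\<dots> = (M * t) ^ Suc k / fact (Suc k)"
    using integral_unique[OF prim] by simp
  finally show ?case by simp
qed simp

text \<open>Absolute convergence of the exponential series passes to any injective selection of its
  terms. It is used for the even and for the odd levels separately.\<close>

lemma summable_power_over_fact_subseq:
  fixes x :: real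
  assumes "inj h"
  shows "summable (\<lambda>n. x ^ h n / fact (h n))"
proof (rule summable_rabs_cancel)
  have "(\<lambda>n. \<bar>x\<bar> ^ n / fact n) summable_on UNIV"
    using summable_exp[of "\<bar>x\<bar>"]
    by (subst summable_on_UNIV_nonneg_real_iff) (auto simp: field_simps)
  then have "(\<lambda>n. \<bar>x\<bar> ^ n / fact n) summable_on range h"
    using summable_on_subset_banach by blast
  then have "(\<lambda>n. \<bar>x\<bar> ^ h n / fact (h n)) summable_on UNIV"
    using summable_on_reindex[OF assms, of "\<lambda>n. \<bar>x\<bar> ^ n / fact n"] by (simp add: o_def)
  then show "summable (\<lambda>n. \<bar>x ^ h n / fact (h n)\<bar>)"
    by (subst (asm) summable_on_UNIV_nonneg_real_iff) (auto simp: power_abs)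
qed

text \<open>Termwise differentiation is allowed because the factorial bound majorises the
  differentiated series uniformly on \<open>{0..t+1}\<close>, so the Weierstrass test
  applies.\<close>

lemma iterated_integral_series_has_derivative:
  assumes cont: "\<And>k. continuous_on {0..} (c k)"
    and bound: "\<And>k t. t \<ge> 0 \<Longrightarrow> \<bar>c k t\<bar> \<le> M" and "inj h" "t \<ge> 0"
  shows "((\<lambda>t. \<Sum>n. iterated_integral c (Suc (h n)) t) has_real_derivative
      (\<Sum>n. c (h n) t * iterated_integral c (h n) t)) (at t within {0..})"
proof -
  have M: "M \<ge> 0" using bound[of 0 0] by simp
  let ?S = "{0..t+1}"
  have bd: "norm (c (h n) s * iterated_integral c (h n) s) \<le> M * ((M * (t+1)) ^ h n / fact (h n))"
    if "s \<in> ?S" for n s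
  proof -
    have "\<bar>iterated_integral c (h n) s\<bar> \<le> (M * s) ^ h n / fact (h n)"
      using that by (intro iterated_integral_bound[OF cont bound]) auto
    also have "\<dots> \<le> (M * (t+1)) ^ h n / fact (h n)"
      using that M by (intro divide_right_mono power_mono mult_left_mono) auto
    finally have "\<bar>c (h n) s\<bar> * \<bar>iterated_integral c (h n) s\<bar> \<le>
        M * ((M * (t+1)) ^ h n / fact (h n))"
      using bound[of s "h n"] that M by (intro mult_mono) auto
    then show ?thesis by (simp add: abs_mult)
  qed
  have ul: "uniform_limit ?S (\<lambda>N s. \<Sum>n<N. c (h n) s * iterated_integral c (h n) s)
      (\<lambda>s. \<Sum>n. c (h n) s * iterated_integral c (h n) s) sequentially"
    by (rule Weierstrass_m_test[OF bd])
      (auto simp del: times_divide_eq_right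
        intro!: summable_mult summable_power_over_fact_subseq[OF \<open>inj h\<close>])
  have der: "(iterated_integral c (Suc (h n)) has_real_derivative
      c (h n) s * iterated_integral c (h n) s) (at s within ?S)" if "s \<in> ?S" for n s
    by (rule has_field_derivative_subset[OF iterated_integral_has_derivative[OF cont]])
      (use that in auto)
  have nbhd: "at t within ?S = at t within {0..}"
    by (rule at_within_nhd[of _ "{..<t+1}"]) (use \<open>t \<ge> 0\<close> in auto)
  \<comment> \<open>Convergence of the undifferentiated series is needed at one point only; at 0
    each of its terms is an integral over a single point and vanishes.\<close>
  obtain G where G: "\<forall>s\<in>?S. (\<lambda>n. iterated_integral c (Suc (h n)) s) sums G s \<and>
      (G has_real_derivative (\<Sum>n. c (h n) s * iterated_integral c (h n) s)) (at s within ?S)"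
    using has_field_derivative_series[OF _ der ul, of 0] \<open>t \<ge> 0\<close> by auto
  have "(G has_real_derivative (\<Sum>n. c (h n) t * iterated_integral c (h n) t)) (at t within ?S)"
    using G \<open>t \<ge> 0\<close> by auto
  then have "((\<lambda>s. \<Sum>n. iterated_integral c (Suc (h n)) s) has_real_derivative
      (\<Sum>n. c (h n) t * iterated_integral c (h n) t)) (at t within ?S)"
    by (rule has_field_derivative_transform_within[OF _ zero_less_one])
      (use G \<open>t \<ge> 0\<close> in \<open>auto dest!: sums_unique bspec\<close>)
  then show ?thesis by (simp add: nbhd)
qed

text \<open>Collect the levels by parity: \<open>f\<close> sums the even ones and \<open>g\<close>
  the odd ones. Differentiation lowers the level by one, with weight 1 when passing from even to odd
  and weight \<open>q\<close> from odd to even.\<close>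

lemma second_order_linear_ode:
  fixes q :: "real \<Rightarrow> real"
  assumes "continuous_on {0..} q" and "\<And>t. t \<ge> 0 \<Longrightarrow> \<bar>q t\<bar> \<le> M"
  obtains f g where "f 0 = 1"
    and "\<And>t. t \<ge> 0 \<Longrightarrow> (f has_real_derivative g t) (at t within {0..})"
    and "\<And>t. t \<ge> 0 \<Longrightarrow> (g has_real_derivative q t * f t) (at t within {0..})"
proof -
  define c :: "nat \<Rightarrow> real \<Rightarrow> real" where "c k t = (if even k then q t else 1)" for k t
  let ?w = "iterated_integral c"
  have cont: "continuous_on {0..} (c k)" for k
    using assms(1) by (cases "even k") (simp_all add: c_def)
  have bound: "\<bar>c k t\<bar> \<le> max M 1" if "t \<ge> 0" for k t
    using assms(2)[OF that] by (auto simp: c_def)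
  \<comment> \<open>Level 0 is the constant 1; it is split off because only successor levels arise
    as integrals.\<close>
  define f where "f t = 1 + (\<Sum>n. ?w (Suc (2 * n + 1)) t)" for t
  define g where "g t = (\<Sum>n. ?w (Suc (2 * n)) t)" for t
  show thesis
  proof (rule that[of f g])
    show "f 0 = 1" by (simp add: f_def)
  next
    fix t :: real assume t: "t \<ge> 0"
    show "(f has_real_derivative g t) (at t within {0..})"
      using DERIV_add[OF DERIV_const[of 1] iterated_integral_series_has_derivative[of c,
        OF cont bound, where h="\<lambda>n. 2 * n + 1" and t=t]] t
      unfolding f_def g_def c_def[of "2 * n + 1" for n]
      by (simp add: inj_def del: iterated_integral.simps)
    have "summable (\<lambda>n. ?w (2 * n) t)"
      by (rule summable_comparison_test'[OF
        summable_power_over_fact_subseq[of "\<lambda>n. 2 * n" "max M 1 * t"]])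
        (use iterated_integral_bound[OF cont bound] t in \<open>auto simp: inj_def\<close>)
    then have "(\<Sum>n. q t * ?w (2 * n) t) = q t * f t"
      using suminf_split_head[of "\<lambda>n. ?w (2 * n) t"] by (simp add: suminf_mult f_def)
    then show "(g has_real_derivative q t * f t) (at t within {0..})"
      using iterated_integral_series_has_derivative[of c, OF cont bound, where h="\<lambda>n. 2 * n" and t=t] t
      unfolding g_def by (auto simp: c_def inj_def)
  qed
qed

section \<open>Energy estimates for the linear oscillator\<close>

text \<open>In \<open>E'\<close> the mixed terms cancel, leaving
  \<open>t / r * g^2 - \<alpha> * t / r^3 * f^2\<close>. The derivative of
  \<open>t / r * f * g\<close> contains the same two terms, so only \<open>- f * g / r^3\<close>
  survives in \<open>H'\<close>. The exponential is an integrating factor, since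
  \<open>t / r\<close> has derivative \<open>(r^2 - t^2) / r^3 = 1 / r^3\<close>;
  \<open>\<kappa>\<close> is left free so that both signs can be used.\<close>

lemma oscillator_energy_identity:
  fixes f g :: "real \<Rightarrow> real" and \<alpha> \<kappa> t :: real
  defines "r \<equiv> \<lambda>t. sqrt (1 + t\<^sup>2)"
  defines "H \<equiv> \<lambda>t. \<alpha> / r t * (f t)\<^sup>2 + r t * (g t)\<^sup>2 - t / r t * f t * g t"
  assumes f: "(f has_real_derivative g t) (at t within S)"
    and g: "(g has_real_derivative - \<alpha> * f t / (1 + t\<^sup>2)) (at t within S)"
  shows "((\<lambda>t. H t * exp (\<kappa> * (t / r t))) has_real_derivative
    (\<kappa> * H t - f t * g t) / r t ^ 3 * exp (\<kappa> * (t / r t))) (at t within S)"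
proof -
  have r0: "r t > 0" and r2: "1 + t\<^sup>2 = (r t)\<^sup>2"
    by (simp_all add: r_def add_pos_nonneg)
  have r: "(r has_real_derivative t / r t) (at t within S)"
  proof -
    have "((\<lambda>t. 1 + t\<^sup>2) has_real_derivative 2 * t) (at t within S)"
      by (auto intro!: derivative_eq_intros)
    from DERIV_chain2[OF DERIV_real_sqrt this] show ?thesis
      using r0 by (simp add: r_def field_simps)
  qed
  have tr: "((\<lambda>t. t / r t) has_real_derivative 1 / r t ^ 3) (at t within S)"
    by (rule derivative_eq_intros r refl)+
      (use r0 r2 in \<open>auto simp: field_simps power2_eq_square power3_eq_cube\<close>)
  have \<alpha>r: "((\<lambda>t. \<alpha> / r t) has_real_derivative - (\<alpha> * t) / r t ^ 3) (at t within S)"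
    by (rule derivative_eq_intros r refl)+
      (use r0 in \<open>auto simp: field_simps power3_eq_cube\<close>)
  have H: "(H has_real_derivative - f t * g t / r t ^ 3) (at t within S)"
    unfolding H_def r2
    by (rule \<alpha>r tr r f g[unfolded r2] derivative_eq_intros refl)+
      (use r0 in \<open>simp add: field_simps power2_eq_square power3_eq_cube\<close>)
  show ?thesis
    by (rule H tr derivative_eq_intros refl)+ (use r0 in \<open>simp add: field_simps\<close>)
qed

text \<open>This is the constant in \<open>\<bar>f * g\<bar> \<le> \<delta> * E\<close>. The
  threshold 1/4 is exactly the condition for it to be below 1, so that the correction term cannot
  exhaust the energy.\<close>

lemma oscillator_coupling_bounds:
  fixes \<alpha> :: real
  assumes "\<alpha> > 1 / 4"
  shows "0 < 1 / (2 * sqrt \<alpha>)" "1 / (2 * sqrt \<alpha>) < 1"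
proof -
  have "sqrt \<alpha> > sqrt ((1 / 2)\<^sup>2)"
    using assms by (simp only: real_sqrt_less_iff) (simp add: power2_eq_square)
  then have "2 * sqrt \<alpha> > 1" by simp
  then show "0 < 1 / (2 * sqrt \<alpha>)" "1 / (2 * sqrt \<alpha>) < 1"
    using assms by (simp_all add: divide_less_eq)
qed

text \<open>Passing between \<open>H\<close> and \<open>E\<close> at time \<open>T\<close> costs the
  factors \<open>1 - \<delta>\<close> and \<open>1 + \<delta>\<close>; at time 0 the two agree, so
  nothing is lost there. The exponentials come from Gronwall, with \<open>\<kappa>\<close> chosen so
  that \<open>\<delta> * E \<le> \<kappa> * H\<close>.\<close>

lemma oscillator_energy_bounds:
  fixes f g :: "real \<Rightarrow> real" and \<alpha> T :: real
  defines "\<delta> \<equiv> 1 / (2 * sqrt \<alpha>)"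
  defines "\<kappa> \<equiv> \<delta> / (1 - \<delta>)"
  assumes \<alpha>: "\<alpha> > 1 / 4" and T: "T \<ge> 0"
    and f: "\<And>t. t \<ge> 0 \<Longrightarrow> (f has_real_derivative g t) (at t within {0..})"
    and g: "\<And>t. t \<ge> 0 \<Longrightarrow> (g has_real_derivative - \<alpha> * f t / (1 + t\<^sup>2)) (at t within {0..})"
  shows "exp (-\<kappa>) / (1 + \<delta>) * wave_energy \<alpha> f g 0 \<le> wave_energy \<alpha> f g T"
    and "wave_energy \<alpha> f g T \<le> exp \<kappa> / (1 - \<delta>) * wave_energy \<alpha> f g 0"
proof -
  have \<delta>: "0 < \<delta>" "\<delta> < 1"
    using oscillator_coupling_bounds[OF \<alpha>] by (simp_all add: \<delta>_def)
  define r where "r t = sqrt (1 + t\<^sup>2)" for t :: real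
  define E where "E = wave_energy \<alpha> f g"
  define H where "H t = \<alpha> / r t * (f t)\<^sup>2 + r t * (g t)\<^sup>2 - t / r t * f t * g t" for t
  have r0: "r t > 0" for t by (simp add: r_def add_pos_nonneg)
  have E: "E t = \<alpha> / r t * (f t)\<^sup>2 + r t * (g t)\<^sup>2" for t
    using \<alpha> by (simp add: E_def wave_energy_def r_def)
  have E0: "E t \<ge> 0" for t using \<alpha> r0[of t] by (simp add: E)
  have fg: "\<bar>f t * g t\<bar> \<le> \<delta> * E t" for t
  proof -
    \<comment> \<open>The weights make the sum of squares equal to \<open>E\<close>, while the
      factors \<open>r\<close> cancel in \<open>a * b\<close>; then
      \<open>2 * a * b \<le> a^2 + b^2\<close> gives the claim.\<close>
    define a where "a = sqrt \<alpha> / sqrt (r t) * \<bar>f t\<bar>"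
    define b where "b = sqrt (r t) * \<bar>g t\<bar>"
    have "a\<^sup>2 + b\<^sup>2 = E t" "a * b = sqrt \<alpha> * \<bar>f t * g t\<bar>"
      using \<alpha> r0[of t] by (simp_all add: a_def b_def E power_mult_distrib power_divide abs_mult)
    moreover have "2 * (a * b) \<le> a\<^sup>2 + b\<^sup>2"
      using sum_squares_bound[of a b] by simp
    ultimately show ?thesis
      using \<alpha> by (simp add: \<delta>_def pos_le_divide_eq mult_ac)
  qed
  have tr: "0 \<le> t / r t" "t / r t \<le> 1" if "t \<ge> 0" for t
    using that r0[of t] by (auto simp: r_def intro!: real_le_rsqrt)
  have HE: "(1 - \<delta>) * E t \<le> H t" "H t \<le> (1 + \<delta>) * E t" if "t \<ge> 0" for t
  proof -
    have "\<bar>t / r t * (f t * g t)\<bar> \<le> 1 * (\<delta> * E t)"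
      unfolding abs_mult by (rule mult_mono) (use tr[OF that] fg[of t] in auto)
    moreover have "H t = E t - t / r t * (f t * g t)"
      by (simp add: H_def E)
    ultimately show "(1 - \<delta>) * E t \<le> H t" "H t \<le> (1 + \<delta>) * E t"
      unfolding left_diff_distrib distrib_right by linarith+
  qed
  have fgH: "\<bar>f t * g t\<bar> \<le> \<kappa> * H t" if "t \<ge> 0" for t
  proof -
    have "\<kappa> * ((1 - \<delta>) * E t) \<le> \<kappa> * H t"
      using HE[OF that] \<delta> by (intro mult_left_mono) (auto simp: \<kappa>_def)
    then show ?thesis using fg[of t] \<delta> by (simp add: \<kappa>_def)
  qed
  have der: "((\<lambda>t. H t * exp (k * (t / r t))) has_real_derivative
      (k * H t - f t * g t) / r t ^ 3 * exp (k * (t / r t))) (at t within {0..})" if "t \<ge> 0" for k t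
    using oscillator_energy_identity[OF f[OF that] g[OF that]]
    unfolding H_def r_def .
  \<comment> \<open>The monotonicity criteria ask for two-sided derivatives in the open interval and
    only for continuity at its ends.\<close>
  have der': "((\<lambda>t. H t * exp (k * (t / r t))) has_real_derivative
      (k * H t - f t * g t) / r t ^ 3 * exp (k * (t / r t))) (at t)" if "t > 0" for k t
    using der[of t k] that by (simp add: at_within_interior[of t "{0..}"])
  have cont: "continuous_on {0..T} (\<lambda>t. H t * exp (k * (t / r t)))" for k
    using DERIV_continuous[OF der]
    by (intro continuous_on_subset[of "{0..}" _ "{0..T}"])
      (auto simp: continuous_on_eq_continuous_within simp del: times_divide_eq_right)
  have H0: "H 0 = E 0" by (simp add: H_def E)
  \<comment> \<open>With the weight \<open>\<kappa>\<close> the derivative has the sign of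
    \<open>\<kappa> * H - f * g\<close>, which is nonnegative.\<close>
  have "H 0 * exp (\<kappa> * (0 / r 0)) \<le> H T * exp (\<kappa> * (T / r T))"
  proof (rule DERIV_nonneg_imp_increasing_open[OF T _ cont])
    fix t :: real assume "0 < t"
    then show "\<exists>y. ((\<lambda>t. H t * exp (\<kappa> * (t / r t))) has_real_derivative y) (at t) \<and> 0 \<le> y"
      using fgH[of t] r0[of t]
      by (intro exI[of _ "(\<kappa> * H t - f t * g t) / r t ^ 3 * exp (\<kappa> * (t / r t))"] conjI der') auto
  qed
  then have low: "E 0 \<le> H T * exp (\<kappa> * (T / r T))" by (simp add: H0)
  \<comment> \<open>With the weight \<open>- \<kappa>\<close> the sign is that of
    \<open>- \<kappa> * H - f * g\<close>, which is nonpositive.\<close>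
  have "H T * exp (- \<kappa> * (T / r T)) \<le> H 0 * exp (- \<kappa> * (0 / r 0))"
  proof (rule DERIV_nonpos_imp_decreasing_open[OF T _ cont])
    fix t :: real assume "0 < t"
    then show "\<exists>y. ((\<lambda>t. H t * exp (- \<kappa> * (t / r t))) has_real_derivative y) (at t) \<and> y \<le> 0"
      using fgH[of t] r0[of t]
      by (intro exI[of _ "(- \<kappa> * H t - f t * g t) / r t ^ 3 * exp (- \<kappa> * (t / r t))"] conjI der')
        (auto intro!: mult_nonpos_nonneg divide_nonpos_pos)
  qed
  then have up: "H T * exp (- (\<kappa> * (T / r T))) \<le> E 0" by (simp add: H0)
  have HT: "H T \<ge> 0" using HE(1)[OF T] E0[of T] \<delta> by (smt (verit) mult_nonneg_nonneg)
  have k0: "\<kappa> \<ge> 0" using \<delta> by (simp add: \<kappa>_def)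
  \<comment> \<open>As \<open>T / r T \<le> 1\<close>, the exponential factor is bounded
    independently of \<open>T\<close>.\<close>
  have ex: "exp (\<kappa> * (T / r T)) \<le> exp \<kappa>"
    using tr[OF T] k0 by (simp add: mult_left_le del: times_divide_eq_right)
  have "E 0 \<le> H T * exp \<kappa>"
    using low mult_left_mono[OF ex HT] by linarith
  also have "\<dots> \<le> (1 + \<delta>) * E T * exp \<kappa>"
    using HE(2)[OF T] by (intro mult_right_mono) auto
  finally have "E 0 / ((1 + \<delta>) * exp \<kappa>) \<le> E T"
    using \<delta> by (subst pos_divide_le_eq) (simp_all add: mult_ac)
  then show "exp (-\<kappa>) / (1 + \<delta>) * wave_energy \<alpha> f g 0 \<le> wave_energy \<alpha> f g T"
    by (simp add: E_def exp_minus divide_inverse mult_ac)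
  have "(1 - \<delta>) * E T \<le> H T" by (rule HE(1)[OF T])
  also have "\<dots> \<le> E 0 * exp (\<kappa> * (T / r T))"
    using up by (simp add: exp_minus field_simps)
  also have "\<dots> \<le> E 0 * exp \<kappa>" using ex E0[of 0] by (intro mult_left_mono)
  finally show "wave_energy \<alpha> f g T \<le> exp \<kappa> / (1 - \<delta>) * wave_energy \<alpha> f g 0"
    using \<delta> by (simp add: E_def field_simps)
qed

section \<open>The wave fields and their derivatives\<close>

lemma one_plus_square_neq_0: "1 + t\<^sup>2 \<noteq> (0 :: real)"
  by (metis add_pos_nonneg less_irrefl zero_le_power2 zero_less_one)

text \<open>The velocity with the perpendicular gradient evaluated. \<open>F\<close> is the
  amplitude of the stream function of the wave, and all derivatives are computed in terms of
  it.\<close>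

definition shear_wave :: "(real \<Rightarrow> real) \<Rightarrow> real \<Rightarrow> real \<Rightarrow> real \<Rightarrow> real \<times> real"
  where "shear_wave F t x y = (y + F t * t * sin (x - t * y), F t * sin (x - t * y))"

lemma wave_velocity_eq_shear_wave: "wave_velocity f = shear_wave (\<lambda>t. f t / (1 + t\<^sup>2))"
proof (intro ext)
  fix t x y
  have "((\<lambda>r. cos (r - t * y)) has_vector_derivative - sin (x - t * y)) (at x)"
    unfolding has_real_derivative_iff_has_vector_derivative[symmetric]
    by (auto intro!: derivative_eq_intros)
  moreover have "((\<lambda>r. cos (x - t * r)) has_vector_derivative t * sin (x - t * y)) (at y)"
    unfolding has_real_derivative_iff_has_vector_derivative[symmetric]
    by (auto intro!: derivative_eq_intros)
  ultimately show "wave_velocity f t x y = shear_wave (\<lambda>t. f t / (1 + t\<^sup>2)) t x y"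
    by (simp add: wave_velocity_def shear_wave_def grad_perp_def partial_x_def partial_y_def
        vector_derivative_at)
qed

lemma shear_wave_has_vector_derivative:
  "((\<lambda>r. shear_wave F t r y) has_vector_derivative
     (F t * t * cos (x - t * y), F t * cos (x - t * y))) (at x)"
  "((\<lambda>r. shear_wave F t x r) has_vector_derivative
     (1 - F t * t\<^sup>2 * cos (x - t * y), - (F t * t * cos (x - t * y)))) (at y)"
  unfolding shear_wave_def
  by (rule has_vector_derivative_Pair;
      auto simp: has_real_derivative_iff_has_vector_derivative[symmetric] power2_eq_square
        intro!: derivative_eq_intros)+

lemma partial_shear_wave:
  "partial_x (shear_wave F t) x y = (F t * t * cos (x - t * y), F t * cos (x - t * y))"
  "partial_y (shear_wave F t) x y =
     (1 - F t * t\<^sup>2 * cos (x - t * y), - (F t * t * cos (x - t * y)))"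
  unfolding partial_x_def partial_y_def
  by (rule vector_derivative_at shear_wave_has_vector_derivative)+

lemma shear_wave_component_derivatives:
  "partial_x (\<lambda>a b. fst (shear_wave F t a b)) x y = F t * t * cos (x - t * y)"
  "partial_x (\<lambda>a b. snd (shear_wave F t a b)) x y = F t * cos (x - t * y)"
  "partial_y (\<lambda>a b. fst (shear_wave F t a b)) x y = 1 - F t * t\<^sup>2 * cos (x - t * y)"
  "partial_y (\<lambda>a b. snd (shear_wave F t a b)) x y = - (F t * t * cos (x - t * y))"
  unfolding partial_x_def partial_y_def
  using bounded_linear.has_vector_derivative[OF bounded_linear_fst shear_wave_has_vector_derivative(1)]
    bounded_linear.has_vector_derivative[OF bounded_linear_snd shear_wave_has_vector_derivative(1)]
    bounded_linear.has_vector_derivative[OF bounded_linear_fst shear_wave_has_vector_derivative(2)]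
    bounded_linear.has_vector_derivative[OF bounded_linear_snd shear_wave_has_vector_derivative(2)]
  by (auto intro!: vector_derivative_at)

lemma divergence_shear_wave: "divergence (shear_wave F t) x y = 0"
  by (simp add: divergence_def shear_wave_component_derivatives)

text \<open>The wave vector is \<open>(1, - t)\<close>, so the curl multiplies the stream function
  amplitude by its squared length \<open>1 + t^2\<close>, which undoes the division in the velocity.
  The Couette flow contributes -1.\<close>

lemma curl_wave_velocity: "curl (wave_velocity f t) x y = wave_vorticity f t x y"
proof -
  have "f t = f t / (1 + t\<^sup>2) + f t / (1 + t\<^sup>2) * t\<^sup>2"
    using one_plus_square_neq_0[of t]
    by (metis distrib_left mult.right_neutral nonzero_eq_divide_eq)
  then have "f t * cos (x - t * y) =
      f t / (1 + t\<^sup>2) * cos (x - t * y) + f t / (1 + t\<^sup>2) * t\<^sup>2 * cos (x - t * y)"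
    by (metis distrib_right)
  then show ?thesis
    by (simp add: wave_velocity_eq_shear_wave curl_def shear_wave_component_derivatives
        wave_vorticity_def)
qed

lemma partial_wave_temperature:
  "partial_x (wave_temperature \<alpha> g t) x y = g t * cos (x - t * y)"
  "partial_y (wave_temperature \<alpha> g t) x y = \<alpha> - g t * t * cos (x - t * y)"
  unfolding partial_x_def partial_y_def wave_temperature_def
  by (rule vector_derivative_at;
      auto simp: has_real_derivative_iff_has_vector_derivative[symmetric]
        intro!: derivative_eq_intros)+

lemma vector_derivative_within_atLeast:
  fixes f :: "real \<Rightarrow> 'a::real_normed_vector"
  assumes "(f has_vector_derivative f') (at t within {a..})" "t \<ge> a"
  shows "vector_derivative f (at t within {a..}) = f'"
proof (rule vector_derivative_within)
  \<comment> \<open>All points to the right of \<open>t\<close> lie in the half line, so the filter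
    is nontrivial and the derivative unique even at \<open>t = a\<close>.\<close>
  have "at_right t \<le> at t within {a..}"
    using assms(2) by (intro at_le) auto
  then show "at t within {a..} \<noteq> bot"
    by (metis bot.extremum_unique trivial_limit_at_right_real)
qed (rule assms)

lemma partial_t_shear_wave:
  assumes "(F has_real_derivative D) (at t within {0..})" "t \<ge> 0"
  shows "partial_t (shear_wave F) t x y =
    ((D * t + F t) * sin (x - t * y) - F t * t * y * cos (x - t * y),
     D * sin (x - t * y) - F t * y * cos (x - t * y))"
  unfolding partial_t_def shear_wave_def
  by (rule vector_derivative_within_atLeast has_vector_derivative_Pair assms(2))+
    (auto simp: has_real_derivative_iff_has_vector_derivative[symmetric] algebra_simps
      intro!: derivative_eq_intros assms)

lemma partial_t_wave_temperature:
  assumes "(g has_real_derivative D) (at t within {0..})" "t \<ge> 0"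
  shows "partial_t (wave_temperature \<alpha> g) t x y =
    D * sin (x - t * y) - g t * y * cos (x - t * y)"
  unfolding partial_t_def wave_temperature_def
  by (rule vector_derivative_within_atLeast assms(2))+
    (auto simp: has_real_derivative_iff_has_vector_derivative[symmetric] algebra_simps
      intro!: derivative_eq_intros assms)

lemma periodic_wave: "periodic_x (shear_wave F t)" "periodic_x (wave_temperature \<alpha> g t)"
proof -
  have "sin (x + 2 * pi - z) = sin (x - z)" for x z
    using sin_periodic[of "x - z"] by (simp add: algebra_simps)
  then show "periodic_x (shear_wave F t)" "periodic_x (wave_temperature \<alpha> g t)"
    by (simp_all add: periodic_x_def shear_wave_def wave_temperature_def)
qed

section \<open>Regularity of the wave fields\<close>

lemma differentiable_on_fst_Times:
  fixes F :: "real \<Rightarrow> real"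
  assumes "\<And>t. t \<in> A \<Longrightarrow> (F has_real_derivative D t) (at t within A)"
  shows "(\<lambda>p. F (fst p)) differentiable_on (A \<times> B)"
  unfolding differentiable_on_def
proof
  fix p assume p: "p \<in> A \<times> B"
  then have "(F has_real_derivative D (fst p)) (at (fst p) within fst ` (A \<times> B))"
    by (intro has_field_derivative_subset[OF assms]) auto
  then have "F differentiable (at (fst p) within fst ` (A \<times> B))"
    unfolding differentiable_def has_field_derivative_def by blast
  then show "(\<lambda>p. F (fst p)) differentiable (at p within A \<times> B)"
    using differentiable_chain_within[of fst p "A \<times> B" F]
    by (simp add: o_def bounded_linear_imp_differentiable bounded_linear_fst)
qed

lemma differentiable_on_Pair:
  assumes "f differentiable_on S" "g differentiable_on S"
  shows "(\<lambda>p. (f p, g p)) differentiable_on S"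
  using assms by (auto simp: differentiable_on_def)

lemma differentiable_on_wave:
  "(\<lambda>p::real \<times> real \<times> real. sin (fst (snd p) - fst p * snd (snd p))) differentiable_on S"
  "(\<lambda>p::real \<times> real \<times> real. fst p) differentiable_on S"
  "(\<lambda>p::real \<times> real \<times> real. snd (snd p)) differentiable_on S"
  unfolding differentiable_on_def differentiable_def
  by (rule ballI exI derivative_intros)+

lemma continuous_on_atLeast_if_has_real_derivative:
  fixes F :: "real \<Rightarrow> real"
  assumes "\<And>t. t \<ge> a \<Longrightarrow> (F has_real_derivative D t) (at t within {a..})"
  shows "continuous_on {a..} F"
  using DERIV_continuous[OF assms] by (auto simp: continuous_on_eq_continuous_within)

lemma C1_field_shear_wave:
  assumes D: "\<And>t. t \<ge> 0 \<Longrightarrow> (F has_real_derivative D t) (at t within {0..})"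
    and "continuous_on {0..} D"
  shows "C1_field (shear_wave F)"
proof -
  let ?S = "{0..} \<times> (UNIV :: (real \<times> real) set)"
  have DS: "continuous_on ?S (\<lambda>p. D (fst p))"
    by (rule continuous_on_compose2[OF assms(2)]) (auto intro!: continuous_intros)
  have FS: "continuous_on ?S (\<lambda>p. F (fst p))"
    by (rule continuous_on_compose2[OF continuous_on_atLeast_if_has_real_derivative[OF D]])
      (auto intro!: continuous_intros)
  have "(\<lambda>p. F (fst p)) differentiable_on ?S"
    by (rule differentiable_on_fst_Times) (use D in auto)
  then have "(\<lambda>(t, x, y). shear_wave F t x y) differentiable_on ?S"
    unfolding shear_wave_def case_prod_beta
    by (intro differentiable_on_Pair differentiable_on_add differentiable_on_mult
        differentiable_on_wave)
  \<comment> \<open>The formula for \<open>partial_t\<close> is available for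
    \<open>t \<ge> 0\<close> only, hence a congruence on the domain.\<close>
  moreover have "continuous_on ?S (\<lambda>(t, x, y). partial_t (shear_wave F) t x y) \<longleftrightarrow>
      continuous_on ?S (\<lambda>(t, x, y).
        ((D t * t + F t) * sin (x - t * y) - F t * t * y * cos (x - t * y),
         D t * sin (x - t * y) - F t * y * cos (x - t * y)))"
    by (rule continuous_on_cong) (auto simp: partial_t_shear_wave[OF D])
  moreover have "\<dots>"
    unfolding case_prod_beta by (intro continuous_intros DS FS)
  moreover have "continuous_on ?S (\<lambda>(t, x, y). partial_x (shear_wave F t) x y)"
    unfolding partial_shear_wave case_prod_beta by (intro continuous_intros FS)
  moreover have "continuous_on ?S (\<lambda>(t, x, y). partial_y (shear_wave F t) x y)"
    unfolding partial_shear_wave case_prod_beta by (intro continuous_intros FS)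
  ultimately show ?thesis unfolding C1_field_def by blast
qed

lemma C1_field_wave_temperature:
  assumes D: "\<And>t. t \<ge> 0 \<Longrightarrow> (g has_real_derivative D t) (at t within {0..})"
    and "continuous_on {0..} D"
  shows "C1_field (wave_temperature \<alpha> g)"
proof -
  let ?S = "{0..} \<times> (UNIV :: (real \<times> real) set)"
  have DS: "continuous_on ?S (\<lambda>p. D (fst p))"
    by (rule continuous_on_compose2[OF assms(2)]) (auto intro!: continuous_intros)
  have gS: "continuous_on ?S (\<lambda>p. g (fst p))"
    by (rule continuous_on_compose2[OF continuous_on_atLeast_if_has_real_derivative[OF D]])
      (auto intro!: continuous_intros)
  have "(\<lambda>p. g (fst p)) differentiable_on ?S"
    by (rule differentiable_on_fst_Times) (use D in auto)
  then have "(\<lambda>(t, x, y). wave_temperature \<alpha> g t x y) differentiable_on ?S"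
    unfolding wave_temperature_def case_prod_beta
    by (intro differentiable_on_add differentiable_on_mult differentiable_on_const
        differentiable_on_wave)
  moreover have "continuous_on ?S (\<lambda>(t, x, y). partial_t (wave_temperature \<alpha> g) t x y) \<longleftrightarrow>
      continuous_on ?S (\<lambda>(t, x, y). D t * sin (x - t * y) - g t * y * cos (x - t * y))"
    by (rule continuous_on_cong) (auto simp: partial_t_wave_temperature[OF D])
  moreover have "\<dots>"
    unfolding case_prod_beta by (intro continuous_intros DS gS)
  moreover have "continuous_on ?S (\<lambda>(t, x, y). partial_x (wave_temperature \<alpha> g t) x y)"
    unfolding partial_wave_temperature case_prod_beta by (intro continuous_intros gS)
  moreover have "continuous_on ?S (\<lambda>(t, x, y). partial_y (wave_temperature \<alpha> g t) x y)"
    unfolding partial_wave_temperature case_prod_beta by (intro continuous_intros gS)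
  ultimately show ?thesis unfolding C1_field_def by blast
qed

section \<open>Equivalence of the wave equations with the linear system\<close>

text \<open>Couette advection removes the \<open>y * cos\<close> terms of the time derivative. The
  velocity of the wave is parallel to \<open>(t, 1)\<close>, hence orthogonal to the wave vector, so
  the quadratic terms vanish. One \<open>F\<close> in \<open>2 * F\<close> comes from
  differentiating \<open>F t * t\<close>, the other from the wave advecting the Couette
  profile.\<close>

lemma shear_wave_transport:
  assumes "(F has_real_derivative D) (at t within {0..})" "t \<ge> 0"
  shows "partial_t (shear_wave F) t x y + advect (shear_wave F t) (shear_wave F t) x y =
    ((D * t + 2 * F t) * sin (x - t * y), D * sin (x - t * y))"
  by (simp add: partial_t_shear_wave[OF assms] advect_def partial_shear_wave)
    (simp add: shear_wave_def algebra_simps power2_eq_square)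

text \<open>The same cancellations occur; \<open>\<alpha> * F t\<close> is the vertical velocity
  acting on the stratification \<open>\<alpha> * y\<close>.\<close>

lemma wave_temperature_transport:
  assumes "(g has_real_derivative D) (at t within {0..})" "t \<ge> 0"
  shows "partial_t (wave_temperature \<alpha> g) t x y +
    advect (shear_wave F t) (wave_temperature \<alpha> g t) x y = (D + \<alpha> * F t) * sin (x - t * y)"
  by (simp add: partial_t_wave_temperature[OF assms] advect_def partial_wave_temperature)
    (simp add: shear_wave_def algebra_simps power2_eq_square)

text \<open>Freezing the space point lets differentiability of the amplitudes be read off from that
  of the fields.\<close>

lemma C1_field_compose_atLeast:
  assumes "C1_field u" "t \<ge> 0"
  shows "(\<lambda>t. u t x y) differentiable (at t within {0..})"
proof -
  let ?S = "{0..} \<times> (UNIV :: (real \<times> real) set)"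
  have "(\<lambda>(t, x, y). u t x y) differentiable (at (t, x, y) within ?S)"
    using assms by (auto simp: C1_field_def differentiable_on_def)
  then have "(\<lambda>(t, x, y). u t x y) differentiable
      (at (t, x, y) within (\<lambda>t. (t, x, y)) ` {0..})"
    by (rule differentiable_within_subset) auto
  moreover have "(\<lambda>t. (t, x, y)) differentiable (at t within {0..})"
    by (intro differentiable_Pair) auto
  ultimately show ?thesis
    using differentiable_chain_within[of "\<lambda>t. (t, x, y)" t "{0..}" "\<lambda>(t, x, y). u t x y"]
    by (simp add: o_def)
qed

lemma boussinesq_solution_waveI:
  assumes f: "\<And>t. t \<ge> 0 \<Longrightarrow> (f has_real_derivative g t) (at t within {0..})"
    and g: "\<And>t. t \<ge> 0 \<Longrightarrow> (g has_real_derivative - \<alpha> * f t / (1 + t\<^sup>2)) (at t within {0..})"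
  shows "boussinesq_solution (wave_velocity f) (wave_vorticity f) (wave_temperature \<alpha> g)"
proof -
  define F where "F t = f t / (1 + t\<^sup>2)" for t
  \<comment> \<open>The quotient rule for \<open>F\<close> with \<open>f' = g\<close>, where
    \<open>f t / (1 + t^2)\<close> is written as \<open>F t\<close> again.\<close>
  define D where "D t = (g t - 2 * t * F t) / (1 + t\<^sup>2)" for t
  note n0 = one_plus_square_neq_0
  have D: "(F has_real_derivative D t) (at t within {0..})" if "t \<ge> 0" for t
  proof -
    have "((\<lambda>t. 1 + t\<^sup>2) has_real_derivative 2 * t) (at t within {0..})"
      by (auto intro!: derivative_eq_intros)
    from DERIV_divide[OF f[OF that] this n0] show ?thesis
      unfolding F_def[abs_def] by (rule DERIV_cong)
        (use n0[of t] in \<open>simp add: D_def F_def divide_simps\<close>)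
  qed
  have g': "(g has_real_derivative - \<alpha> * F t) (at t within {0..})" if "t \<ge> 0" for t
    using g[OF that] by (simp add: F_def)
  have cF: "continuous_on {0..} F" and cg: "continuous_on {0..} g"
    using continuous_on_atLeast_if_has_real_derivative[of 0, OF D]
      continuous_on_atLeast_if_has_real_derivative[of 0, OF g] by auto
  have cD: "continuous_on {0..} D"
    unfolding D_def[abs_def] by (intro continuous_intros cF cg ballI n0)
  have V: "wave_velocity f = shear_wave F"
    by (simp add: wave_velocity_eq_shear_wave F_def[abs_def])
  \<comment> \<open>The first momentum component forces the \<open>x\<close>-derivative of the
    pressure to be \<open>- P t * sin (x - t * y)\<close>. The term
    \<open>\<alpha> * y^2 / 2\<close> balances the buoyancy of the background temperature.\<close>
  define P where "P t = D t * t + 2 * F t" for t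
  define p where "p t x y = \<alpha> * y\<^sup>2 / 2 + P t * cos (x - t * y)" for t x y
  have gradp: "grad (p t) x y = (- P t * sin (x - t * y), \<alpha> * y + P t * t * sin (x - t * y))" for t x y
    unfolding grad_def partial_x_def partial_y_def p_def prod.inject
    by (intro conjI; rule vector_derivative_at;
        auto simp: has_real_derivative_iff_has_vector_derivative[symmetric]
          intro!: derivative_eq_intros)
  have "(\<lambda>(x, y). p t x y) differentiable_on UNIV" for t
    unfolding p_def case_prod_beta differentiable_on_def differentiable_def
    by (rule ballI exI derivative_intros | simp)+
  moreover have "periodic_x (p t)" for t
  proof -
    have "cos (x + 2 * pi - z) = cos (x - z)" for x z
      using cos_periodic[of "x - z"] by (simp add: algebra_simps)
    then show ?thesis by (simp add: periodic_x_def p_def)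
  qed
  moreover have "partial_t (shear_wave F) t x y + advect (shear_wave F t) (shear_wave F t) x y +
      grad (p t) x y = wave_temperature \<alpha> g t x y *\<^sub>R (0, 1)" if "t \<ge> 0" for t x y
  proof -
    \<comment> \<open>What is left is the second momentum component, which amounts to
      \<open>D t + P t * t = g t\<close>.\<close>
    have "D t * (1 + t\<^sup>2) = g t - 2 * t * F t"
      using n0[of t] by (simp add: D_def)
    then have "D t + P t * t = g t"
      by (simp add: P_def algebra_simps power2_eq_square)
    then have "D t * sin (x - t * y) + P t * t * sin (x - t * y) = g t * sin (x - t * y)"
      by (metis distrib_right)
    then show ?thesis
      unfolding shear_wave_transport[OF D[OF that] that] gradp
      by (simp add: wave_temperature_def P_def algebra_simps)
  qed
  ultimately have "\<exists>p. (\<forall>t\<ge>0. periodic_x (p t) \<and> (\<lambda>(x, y). p t x y) differentiable_on UNIV) \<and>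
      (\<forall>t\<ge>0. \<forall>x y. partial_t (shear_wave F) t x y + advect (shear_wave F t) (shear_wave F t) x y +
        grad (p t) x y = wave_temperature \<alpha> g t x y *\<^sub>R (0, 1))"
    by (intro exI[of _ p]) blast
  moreover have "C1_field (shear_wave F)"
    by (rule C1_field_shear_wave[OF D cD])
  moreover have "C1_field (wave_temperature \<alpha> g)"
    by (rule C1_field_wave_temperature[OF g']) (auto intro!: continuous_intros cF)
  moreover have "partial_t (wave_temperature \<alpha> g) t x y +
      advect (shear_wave F t) (wave_temperature \<alpha> g t) x y = 0" if "t \<ge> 0" for t x y
    using wave_temperature_transport[OF g'[OF that] that] by simp
  ultimately show ?thesis
    unfolding boussinesq_solution_def
    using curl_wave_velocity[of f, unfolded V, symmetric] divergence_shear_wave periodic_wave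
    unfolding V by simp
qed

text \<open>The amplitudes are arbitrary functions here, so their differentiability has to be
  extracted from the fields before the equations can be compared.\<close>

lemma boussinesq_solution_waveD:
  assumes sol: "boussinesq_solution (wave_velocity f) (wave_vorticity f) (wave_temperature \<alpha> g)"
    and t: "t \<ge> 0"
  shows "(f has_real_derivative g t) (at t within {0..})"
    and "(g has_real_derivative - \<alpha> * f t / (1 + t\<^sup>2)) (at t within {0..})"
proof -
  define F where "F t = f t / (1 + t\<^sup>2)" for t
  note n0 = one_plus_square_neq_0
  have V: "wave_velocity f = shear_wave F"
    by (simp add: wave_velocity_eq_shear_wave F_def[abs_def])
  have C1: "C1_field (shear_wave F)" "C1_field (wave_temperature \<alpha> g)"
    using sol by (auto simp: boussinesq_solution_def V)
  \<comment> \<open>At \<open>y = 0\<close> the phase does not move in time, and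
    \<open>x = pi / 2\<close> makes the sine equal to 1, so the field values there are the
    amplitudes themselves.\<close>
  have "(\<lambda>t. snd (shear_wave F t (pi / 2) 0)) differentiable (at t within {0..})"
    using C1_field_compose_atLeast[OF C1(1) t, of "pi / 2" 0]
    by (auto simp: differentiable_def intro: has_derivative_snd)
  then obtain D where D: "(F has_real_derivative D) (at t within {0..})"
    by (auto simp: shear_wave_def real_differentiable_def)
  have "g differentiable (at t within {0..})"
    using C1_field_compose_atLeast[OF C1(2) t, of "pi / 2" 0]
    by (simp add: wave_temperature_def)
  then obtain G where G: "(g has_real_derivative G) (at t within {0..})"
    by (auto simp: real_differentiable_def)
  have "partial_t (wave_temperature \<alpha> g) t (pi / 2) 0 +
      advect (shear_wave F t) (wave_temperature \<alpha> g t) (pi / 2) 0 = 0"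
    using sol t by (simp add: boussinesq_solution_def V)
  then have "G = - \<alpha> * f t / (1 + t\<^sup>2)"
    unfolding wave_temperature_transport[OF G t] by (simp add: F_def)
  with G show "(g has_real_derivative - \<alpha> * f t / (1 + t\<^sup>2)) (at t within {0..})"
    by simp
  obtain p where p: "(\<lambda>(x, y). p t x y) differentiable_on UNIV"
    and mom: "\<And>x y. partial_t (shear_wave F) t x y + advect (shear_wave F t) (shear_wave F t) x y +
      grad (p t) x y = wave_temperature \<alpha> g t x y *\<^sub>R (0, 1)"
    using sol t by (auto simp: boussinesq_solution_def V)
  define P where "P = D * t + 2 * F t"
  have gradp: "grad (p t) x y = wave_temperature \<alpha> g t x y *\<^sub>R (0, 1) -
      (P * sin (x - t * y), D * sin (x - t * y))" for x y
    using mom[of x y] unfolding shear_wave_transport[OF D t] P_def by (metis add_diff_cancel_left')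
  have diffx: "(\<lambda>r. p t r y) differentiable (at x)"
    and diffy: "(\<lambda>r. p t x r) differentiable (at y)" for x y
  proof -
    have d: "(\<lambda>(x, y). p t x y) differentiable (at (x, y))"
      using p by (simp add: differentiable_on_def)
    show "(\<lambda>r. p t r y) differentiable (at x)"
      using differentiable_chain_at[of "\<lambda>r. (r, y)" x "\<lambda>(x, y). p t x y"] d
      by (auto simp: o_def intro: differentiable_Pair)
    show "(\<lambda>r. p t x r) differentiable (at y)"
      using differentiable_chain_at[of "\<lambda>r. (x, r)" y "\<lambda>(x, y). p t x y"] d
      by (auto simp: o_def intro: differentiable_Pair)
  qed
  have px: "((\<lambda>r. p t r y) has_real_derivative - P * sin (x - t * y)) (at x)" for x y
    using gradp[of x y] diffx[of y x]
    by (simp add: grad_def partial_x_def has_real_derivative_iff_has_vector_derivative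
        vector_derivative_works)
  have py: "((\<lambda>r. p t x r) has_real_derivative
      wave_temperature \<alpha> g t x y - D * sin (x - t * y)) (at y)" for x y
    using gradp[of x y] diffy[of x y]
    by (simp add: grad_def partial_y_def has_real_derivative_iff_has_vector_derivative
        vector_derivative_works)
  \<comment> \<open>The pressure is only known to be differentiable in space, so a finite difference
    in \<open>x\<close> replaces the mixed second derivative: integrating \<open>px\<close> makes it
    explicit, and it is then differentiated in \<open>y\<close>.\<close>
  have "p t x y - P * cos (x - t * y) = p t 0 y - P * cos (0 - t * y)" for x y
    by (rule DERIV_isconst_all) (auto intro!: derivative_eq_intros px)
  from this[of "pi / 2"] have eq: "(\<lambda>y. p t (pi / 2) y - p t 0 y) =
      (\<lambda>y. P * cos (pi / 2 - t * y) - P * cos (0 - t * y))"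
    by (auto simp: algebra_simps fun_eq_iff)
  \<comment> \<open>At \<open>y = 0\<close> the sine is 1 for \<open>x = pi / 2\<close> and 0 for
    \<open>x = 0\<close>, so the two computations of the \<open>y\<close>-derivative give
    \<open>g t - D\<close> and \<open>P * t\<close>.\<close>
  have "((\<lambda>y. p t (pi / 2) y - p t 0 y) has_real_derivative g t - D) (at 0)"
    by (rule derivative_eq_intros py refl)+ (simp add: wave_temperature_def)
  moreover have "((\<lambda>y. P * cos (pi / 2 - t * y) - P * cos (0 - t * y))
      has_real_derivative P * t) (at 0)"
    by (auto intro!: derivative_eq_intros)
  ultimately have "g t - D = P * t"
    unfolding eq by (rule DERIV_unique)
  \<comment> \<open>The left-hand side is the product rule for \<open>F t * (1 + t^2)\<close>, that
    is, for \<open>f\<close>.\<close>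
  then have "D * (1 + t\<^sup>2) + F t * (2 * t) = g t"
    by (simp add: P_def algebra_simps power2_eq_square)
  moreover have "((\<lambda>t. F t * (1 + t\<^sup>2)) has_real_derivative
      D * (1 + t\<^sup>2) + F t * (2 * t)) (at t within {0..})"
    by (auto intro!: derivative_eq_intros D)
  moreover have "(\<lambda>t. F t * (1 + t\<^sup>2)) = f"
    using n0 by (simp add: F_def fun_eq_iff)
  ultimately show "(f has_real_derivative g t) (at t within {0..})"
    by simp
qed

section \<open>Existence of nontrivial waves and uniform energy bounds\<close>

theorem lemma1p2:
  fixes \<alpha> :: real
  assumes "\<alpha> \<ge> 0"
  shows "(\<exists>f g. nontrivial_pair f g \<and>
            boussinesq_solution (wave_velocity f) (wave_vorticity f) (wave_temperature \<alpha> g)) \<and>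
         (\<alpha> > 1 / 4 \<longrightarrow>
           (\<exists>c C. 0 < c \<and> c < C \<and>
             (\<forall>f g. nontrivial_pair f g \<and>
                boussinesq_solution (wave_velocity f) (wave_vorticity f) (wave_temperature \<alpha> g) \<longrightarrow>
                (\<forall>t\<ge>0. c * wave_energy \<alpha> f g 0 \<le> wave_energy \<alpha> f g t \<and>
                       wave_energy \<alpha> f g t \<le> C * wave_energy \<alpha> f g 0))))"
proof (intro conjI impI)
  have pos: "1 + t\<^sup>2 > 0" for t :: real
    by (rule add_pos_nonneg) auto
  have "continuous_on {0..} (\<lambda>t. - \<alpha> / (1 + t\<^sup>2))"
    by (intro continuous_intros ballI less_imp_neq[OF pos, symmetric])
  moreover have "\<bar>- \<alpha> / (1 + t\<^sup>2)\<bar> \<le> \<alpha>" for t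
    using pos[of t] assms by (simp add: divide_le_eq mult_le_cancel_left1)
  \<comment> \<open>The normalisation \<open>f 0 = 1\<close> guarantees nontriviality.\<close>
  ultimately obtain f g where "f 0 = 1"
    and "\<And>t. t \<ge> 0 \<Longrightarrow> (f has_real_derivative g t) (at t within {0..})"
    and "\<And>t. t \<ge> 0 \<Longrightarrow> (g has_real_derivative - \<alpha> / (1 + t\<^sup>2) * f t) (at t within {0..})"
    using second_order_linear_ode by blast
  then have "nontrivial_pair f g"
    "boussinesq_solution (wave_velocity f) (wave_vorticity f) (wave_temperature \<alpha> g)"
    by (auto simp: nontrivial_pair_def intro!: boussinesq_solution_waveI)
  then show "\<exists>f g. nontrivial_pair f g \<and>
      boussinesq_solution (wave_velocity f) (wave_vorticity f) (wave_temperature \<alpha> g)"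
    by blast
next
  assume \<alpha>: "\<alpha> > 1 / 4"
  define \<delta> where "\<delta> = 1 / (2 * sqrt \<alpha>)"
  define \<kappa> where "\<kappa> = \<delta> / (1 - \<delta>)"
  have \<delta>: "0 < \<delta>" "\<delta> < 1"
    using oscillator_coupling_bounds[OF \<alpha>] by (simp_all add: \<delta>_def)
  have cC: "exp (-\<kappa>) / (1 + \<delta>) < 1" "1 < exp \<kappa> / (1 - \<delta>)"
  proof -
    have "0 < \<kappa>" using \<delta> by (simp add: \<kappa>_def)
    then have "exp (-\<kappa>) < 1" "1 < exp \<kappa>" by simp_all
    with \<delta> have "exp (-\<kappa>) < 1 + \<delta>" "1 - \<delta> < exp \<kappa>" by linarith+
    then show "exp (-\<kappa>) / (1 + \<delta>) < 1" "1 < exp \<kappa> / (1 - \<delta>)"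
      using \<delta> by (simp_all add: divide_less_eq less_divide_eq)
  qed
  show "\<exists>c C. 0 < c \<and> c < C \<and>
      (\<forall>f g. nontrivial_pair f g \<and>
         boussinesq_solution (wave_velocity f) (wave_vorticity f) (wave_temperature \<alpha> g) \<longrightarrow>
         (\<forall>t\<ge>0. c * wave_energy \<alpha> f g 0 \<le> wave_energy \<alpha> f g t \<and>
                wave_energy \<alpha> f g t \<le> C * wave_energy \<alpha> f g 0))"
  proof (rule exI[of _ "exp (-\<kappa>) / (1 + \<delta>)"], rule exI[of _ "exp \<kappa> / (1 - \<delta>)"],
      intro conjI allI impI; (elim conjE)?)
    show "0 < exp (-\<kappa>) / (1 + \<delta>)" using \<delta> by simp
    show "exp (-\<kappa>) / (1 + \<delta>) < exp \<kappa> / (1 - \<delta>)" using cC by linarith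
  next
    fix f g and t :: real
    assume "boussinesq_solution (wave_velocity f) (wave_vorticity f) (wave_temperature \<alpha> g)"
      and "t \<ge> 0"
    \<comment> \<open>The constants were fixed before \<open>f\<close> and \<open>g\<close>, so
      every wave solution must be covered, not just the constructed one; each satisfies the linear
      system by the converse direction.\<close>
    note bounds = oscillator_energy_bounds[OF \<alpha> this(2) boussinesq_solution_waveD[OF this(1)],
        folded \<delta>_def \<kappa>_def]
    show "exp (-\<kappa>) / (1 + \<delta>) * wave_energy \<alpha> f g 0 \<le> wave_energy \<alpha> f g t"
      by (rule bounds(1))
    show "wave_energy \<alpha> f g t \<le> exp \<kappa> / (1 - \<delta>) * wave_energy \<alpha> f g 0"
      by (rule bounds(2))
  qed
qed

end
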